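(* Let $n\in\mathbb{N}$, $s,k\in\mathbb{Z}$ and let $f=f_n$ be an even function (mod $n$). Then $$S_f(n,k,s) = n \sum_{\substack{d\mid n\\ (d,s)=1}} \frac{(\mu*f_n)(d)}{d} \sum_{\substack{\delta\mid n\\ (\delta,d)=1\\ \frac{n}{d\delta}\mid k}} \frac{\mu(\delta)}{\delta}\, e(\delta\delta' k/n) = \sum_{t\mid (n,k)} t \sum_{\substack{d\delta=n/t\\ (d,\delta s)=1}} (\mu*f_n)(d)\,\mu(\delta)\, e(\delta\delta' k/n),$$ where, for each pair $(d,\delta)$ occurring in the sums, $\delta'\in\mathbb{Z}$ is any integer such that $\delta\delta'\equiv s \pmod d$.
   Context: $\mathbb{N}=\{1,2,\ldots\}$; $(a,b)$ is the greatest common divisor of $a,b\in\mathbb{Z}$; $\mu$ is the Möbius function; $e(x)=e^{2\pi i x}$ for $x\in\mathbb{R}$. All divisors in sums are positive. For fixed $n\in\mathbb{N}$, a function $f_n:\mathbb{Z}\to\mathbb{C}$ is an even function (mod $n$) if $f_n((a,n))=f_n(a)$ for every $a\in\mathbb{Z}$. For $d\in\mathbb{N}$, $(\mu*f_n)(d)=\sum_{ab=d,\ a,b\in\mathbb{N}}\mu(a)f_n(b)$ (Dirichlet convolution, with $f_n$ restricted to $\mathbb{N}$). For $f=f_n$ even (mod $n$) and $k,s\in\mathbb{Z}$, $$S_f(n,k,s):=\sum_{\substack{a=1\\ (a,n)=1}}^n f_n(a-s)\, e(ak/n).$$ *)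

theory Defs
  imports Complex_Main "HOL-Number_Theory.Number_Theory" "HOL-Computational_Algebra.Squarefree"
begin

definition moebius_mu :: "nat \<Rightarrow> int" where
  "moebius_mu n = (if squarefree n then (-1) ^ card (prime_factors n) else 0)"

(* Only meaningful for d > 0, where a * b = d forces a and b to be positive;
   for d = 0 the index set is infinite and the sum is 0. *)
definition dirichlet_conv :: "(nat \<Rightarrow> complex) \<Rightarrow> (nat \<Rightarrow> complex) \<Rightarrow> nat \<Rightarrow> complex" where
  "dirichlet_conv g h d = (\<Sum>(a, b) | a * b = d. g a * h b)"

definition mu_conv :: "(int \<Rightarrow> complex) \<Rightarrow> nat \<Rightarrow> complex" where
  "mu_conv f = dirichlet_conv (\<lambda>a. of_int (moebius_mu a)) (\<lambda>b. f (int b))"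

definition e :: "real \<Rightarrow> complex" where
  "e x = exp (2 * of_real pi * \<i> * of_real x)"

definition even_function_mod :: "nat \<Rightarrow> (int \<Rightarrow> complex) \<Rightarrow> bool" where
  "even_function_mod n f \<longleftrightarrow> (\<forall>a. f (gcd a (int n)) = f a)"

definition S :: "(int \<Rightarrow> complex) \<Rightarrow> nat \<Rightarrow> int \<Rightarrow> int \<Rightarrow> complex" where
  "S f n k s =
     (\<Sum>a | a \<in> {1..n} \<and> coprime a n. f (int a - s) * e (real_of_int (int a * k) / real n))"

end

theory Submission
  imports Defs
begin

text \<open>Since \<open>f\<close> is even modulo \<open>n\<close>, its value at \<open>a - s\<close> is its value at \<open>gcd (a - s) n\<close>, so Moebius
  inversion writes it as the sum of \<open>(\<mu> * f)(d)\<close> over the divisors \<open>d\<close> of \<open>n\<close> that divide \<open>a - s\<close>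
  (\<open>even_function_mod_expand\<close>). Exchanging the sums reduces \<open>S f n k s\<close> to exponential sums over the
  units \<open>a\<close> modulo \<open>n\<close> in the class of \<open>s\<close> modulo \<open>d\<close>, and there are no such units unless \<open>d\<close> is coprime to
  \<open>s\<close> (\<open>S_expand_divisors\<close>).

  The condition that \<open>a\<close> is a unit modulo \<open>n\<close> is replaced by a sum of \<open>\<mu>(\<delta>)\<close> over the common divisors
  \<open>\<delta>\<close> of \<open>a\<close> and \<open>n\<close> (\<open>sum_coprime_via_moebius\<close>). For \<open>\<delta>\<close> coprime to \<open>d\<close>, the numbers divisible by \<open>\<delta>\<close>
  and congruent to \<open>s\<close> modulo \<open>d\<close> form the class of \<open>\<delta> \<delta>'\<close> modulo \<open>d \<delta>\<close>. The exponential sum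
  over that progression is geometric: it vanishes unless \<open>n / (d \<delta>)\<close> divides \<open>k\<close>, and then it has
  \<open>n / (d \<delta>)\<close> equal terms (\<open>sum_e_arithmetic_progression\<close>). Together these facts express \<open>S f n k s\<close> as
  one double sum over \<open>d\<close> and \<open>\<delta>\<close>. Pulling \<open>n\<close> out of the weight \<open>n / (d \<delta>)\<close> gives the first
  formula, and grouping the terms by \<open>t = n / (d \<delta>)\<close> gives the second.\<close>

section \<open>The Moebius function\<close>

lemma moebius_mu_prime_mult:
  assumes "prime p" "\<not> p dvd d"
  shows "moebius_mu (p * d) = - moebius_mu d"
proof (cases "squarefree d")
  case True
  have cop: "coprime p d" using assms by (simp add: prime_imp_coprime)
  have d0: "d \<noteq> 0" using assms(2) by (intro notI) simp
  have p0: "p \<noteq> 0" using assms by auto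
  have sf: "squarefree (p * d)"
    using squarefree_mult_coprime[OF cop] assms(1) True by (simp add: squarefree_prime)
  have pf: "prime_factors (p * d) = insert p (prime_factors d)"
    using assms d0 p0 by (simp add: prime_factors_product prime_prime_factors)
  have "p \<notin> prime_factors d" using assms(2) by auto
  then have "card (prime_factors (p * d)) = Suc (card (prime_factors d))"
    using pf by simp
  then show ?thesis using True sf by (simp add: moebius_mu_def)
next
  case False
  then have "\<not> squarefree (p * d)" by (meson squarefree_multD(2))
  with False show ?thesis by (simp add: moebius_mu_def)
qed

text \<open>If \<open>p\<close> is a prime factor of \<open>n\<close>, then \<open>d \<mapsto> p * d\<close> matches the divisors of \<open>n\<close> prime to
  \<open>p\<close> with those that \<open>p\<close> divides exactly once, and it reverses the sign of the Moebius function.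
  The remaining divisors are multiples of \<open>p\<^sup>2\<close>, where the Moebius function is \<open>0\<close>.\<close>

lemma sum_moebius_mu_divisors:
  assumes "n > 0"
  shows "(\<Sum>d | d dvd n. moebius_mu d) = (if n = 1 then 1 else 0)"
proof (cases "n = 1")
  case True
  then show ?thesis by (simp add: moebius_mu_def)
next
  case False
  then obtain p where p: "prime p" "p dvd n" using prime_factor_nat by blast
  have fin: "finite {d. d dvd n}" using assms by simp
  let ?A = "{d. d dvd n \<and> \<not> p dvd d}"
  have div_iff: "p * d dvd n" if "d \<in> ?A" for d
    using that p by (intro divides_mult) (auto simp: prime_imp_coprime)
  have inj: "inj_on ((*) p) ?A" using p by (auto simp: inj_on_def)
  have "(\<Sum>d | d dvd n \<and> p dvd d. moebius_mu d) = (\<Sum>d\<in>(*) p ` ?A. moebius_mu d)"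
  proof (rule sum.mono_neutral_right)
    show "finite {d. d dvd n \<and> p dvd d}" using fin by (rule rev_finite_subset) auto
    show "(*) p ` ?A \<subseteq> {d. d dvd n \<and> p dvd d}"
      using div_iff by (intro image_subsetI CollectI conjI) simp_all
    show "\<forall>d\<in>{d. d dvd n \<and> p dvd d} - (*) p ` ?A. moebius_mu d = 0"
    proof
      fix d assume d: "d \<in> {d. d dvd n \<and> p dvd d} - (*) p ` ?A"
      then obtain c where c: "d = p * c" by auto
      from d have "c dvd n" unfolding c by (auto dest: dvd_mult_right)
      with d c have "p dvd c" by auto
      then have "p ^ 2 dvd d" unfolding c by (simp add: power2_eq_square)
      moreover have "\<not> p dvd 1" using p(1) by auto
      ultimately have "\<not> squarefree d" by (rule not_squarefreeI)
      then show "moebius_mu d = 0" by (simp add: moebius_mu_def)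
    qed
  qed
  also have "\<dots> = (\<Sum>d\<in>?A. - moebius_mu d)"
    using inj p(1) by (simp add: sum.reindex moebius_mu_prime_mult)
  finally have "(\<Sum>d | d dvd n \<and> p dvd d. moebius_mu d) = - (\<Sum>d\<in>?A. moebius_mu d)"
    by (simp add: sum_negf)
  moreover have "(\<Sum>d | d dvd n. moebius_mu d)
      = (\<Sum>d | d dvd n \<and> p dvd d. moebius_mu d) + (\<Sum>d\<in>?A. moebius_mu d)"
    using fin by (subst sum.union_disjoint[symmetric]) (auto intro: sum.cong)
  ultimately show ?thesis using False by simp
qed

lemma finite_factor_pairs:
  fixes m :: nat
  assumes "m > 0"
  shows "finite {(a, b). a * b = m}"
proof (rule finite_subset)
  show "{(a, b). a * b = m} \<subseteq> {..m} \<times> {..m}" using assms by auto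
qed simp

text \<open>Moebius inversion. After exchanging the two sums, \<open>f b\<close> is weighted by the sum of the Moebius
  function over the divisors of \<open>m div b\<close>, so only \<open>b = m\<close> survives.\<close>

lemma sum_mu_conv_divisors:
  assumes "m > 0"
  shows "(\<Sum>d | d dvd m. mu_conv f d) = f (int m)"
proof -
  have fin_div: "finite {d. d dvd m}" using assms by simp
  have fin_fact: "finite {(a, b). a * b = d}" if "d dvd m" for d :: nat
    using that assms by (intro finite_factor_pairs) (auto intro: Nat.gr0I)
  have fin_codiv: "finite {a. a dvd m div b}" if "b dvd m" for b
    using that assms by (auto simp: dvd_div_eq_0_iff)
  have "(\<Sum>d | d dvd m. mu_conv f d)
      = (\<Sum>(d, (a, b))\<in>Sigma {d. d dvd m} (\<lambda>d. {(a, b). a * b = d}).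
           of_int (moebius_mu a) * f (int b))"
    unfolding mu_conv_def dirichlet_conv_def
    using fin_div fin_fact by (subst sum.Sigma) (auto intro!: sum.cong)
  also have "\<dots> = (\<Sum>(b, a)\<in>Sigma {b. b dvd m} (\<lambda>b. {a. a dvd m div b}).
                    of_int (moebius_mu a) * f (int b))"
    using assms
    by (intro sum.reindex_bij_witness[where i = "\<lambda>(b, a). (a * b, (a, b))"
              and j = "\<lambda>(d, (a, b)). (b, a)"])
       (auto simp: dvd_div_iff_mult intro: dvd_mult_right)
  also have "\<dots> = (\<Sum>b | b dvd m. f (int b) * of_int (\<Sum>a | a dvd m div b. moebius_mu a))"
    using fin_div fin_codiv
    by (subst sum.Sigma[symmetric]) (auto intro!: sum.cong simp: sum_distrib_left mult.commute)
  also have "\<dots> = (\<Sum>b | b dvd m. if b = m then f (int m) else 0)"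
  proof (rule sum.cong[OF refl])
    fix b assume b: "b \<in> {b. b dvd m}"
    then have pos: "m div b > 0" using assms by (auto elim: dvdE)
    have "m div b = 1 \<longleftrightarrow> b = m" using b assms by (auto elim: dvdE)
    then show "f (int b) * of_int (\<Sum>a | a dvd m div b. moebius_mu a)
               = (if b = m then f (int m) else 0)"
      using sum_moebius_mu_divisors[OF pos] by auto
  qed
  also have "\<dots> = f (int m)" using fin_div by simp
  finally show ?thesis .
qed

text \<open>This is Moebius inversion at \<open>gcd x n\<close>, whose divisors are the divisors of \<open>n\<close> that divide
  \<open>x\<close>.\<close>

lemma even_function_mod_expand:
  assumes "n > 0" "even_function_mod n f"
  shows "f x = (\<Sum>d | d dvd n \<and> int d dvd x. mu_conv f d)"
proof -
  define g where "g = nat (gcd x (int n))"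
  have g: "int g = gcd x (int n)" by (simp add: g_def)
  have "g > 0" unfolding g_def using assms(1) by simp
  have "d dvd g \<longleftrightarrow> d dvd n \<and> int d dvd x" for d
    using g by (metis dvd_gcdD1 dvd_gcdD2 gcd_greatest int_dvd_int_iff)
  then have "(\<Sum>d | d dvd n \<and> int d dvd x. mu_conv f d) = f (int g)"
    using sum_mu_conv_divisors[OF \<open>g > 0\<close>, of f] by simp
  also have "\<dots> = f x" using assms(2) by (simp add: g even_function_mod_def)
  finally show ?thesis by simp
qed

text \<open>The Moebius function, summed over the divisors of \<open>gcd a n\<close>, is the indicator that \<open>a\<close> is coprime
  to \<open>n\<close>.\<close>

lemma sum_coprime_via_moebius:
  fixes g :: "nat \<Rightarrow> complex"
  assumes "n > 0" "finite A"
  shows "(\<Sum>a | a \<in> A \<and> coprime a n. g a)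
       = (\<Sum>\<delta> | \<delta> dvd n. of_int (moebius_mu \<delta>) * (\<Sum>a | a \<in> A \<and> \<delta> dvd a. g a))"
proof -
  have fin: "finite {\<delta>. \<delta> dvd n}" using assms by simp
  have ind: "(\<Sum>\<delta> | \<delta> dvd n \<and> \<delta> dvd a. moebius_mu \<delta>) = (if coprime a n then 1 else 0)" for a
  proof -
    have "{\<delta>. \<delta> dvd n \<and> \<delta> dvd a} = {\<delta>. \<delta> dvd gcd a n}" by auto
    then show ?thesis
      using sum_moebius_mu_divisors[of "gcd a n"] assms(1)
      by (simp only: gcd_pos_nat coprime_iff_gcd_eq_1) simp
  qed
  have "(\<Sum>a | a \<in> A \<and> coprime a n. g a) = (\<Sum>a\<in>A. g a * of_int (if coprime a n then 1 else 0))"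
    using assms(2) by (intro sum.mono_neutral_cong_left) auto
  also have "\<dots> = (\<Sum>a\<in>A. \<Sum>\<delta> | \<delta> \<in> {\<delta>. \<delta> dvd n} \<and> \<delta> dvd a. of_int (moebius_mu \<delta>) * g a)"
  proof (rule sum.cong[OF refl])
    fix a
    have "(\<Sum>\<delta> | \<delta> \<in> {\<delta>. \<delta> dvd n} \<and> \<delta> dvd a. of_int (moebius_mu \<delta>) * g a)
        = of_int (\<Sum>\<delta> | \<delta> dvd n \<and> \<delta> dvd a. moebius_mu \<delta>) * g a"
      by (simp only: mem_Collect_eq of_int_sum sum_distrib_right)
    then show "g a * of_int (if coprime a n then 1 else 0)
        = (\<Sum>\<delta> | \<delta> \<in> {\<delta>. \<delta> dvd n} \<and> \<delta> dvd a. of_int (moebius_mu \<delta>) * g a)"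
      by (simp only: ind mult.commute)
  qed
  also have "\<dots> = (\<Sum>\<delta>\<in>{\<delta>. \<delta> dvd n}. \<Sum>a | a \<in> A \<and> \<delta> dvd a. of_int (moebius_mu \<delta>) * g a)"
    using assms(2) fin by (rule sum.swap_restrict)
  finally show ?thesis by (simp add: sum_distrib_left)
qed

section \<open>Exponential sums over arithmetic progressions\<close>

lemma e_add: "e (x + y) = e x * e y"
  by (simp add: e_def algebra_simps exp_add[symmetric])

lemma e_eq_cis: "e x = cis (2 * pi * x)"
  by (simp add: e_def cis_conv_exp mult_ac)

lemma e_of_int [simp]: "e (real_of_int j) = 1"
  by (simp add: e_eq_cis)

lemma e_of_nat_mult: "e (real j * x) = e x ^ j"
  by (simp add: e_eq_cis DeMoivre mult_ac)

lemma e_eq_1_imp_int: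
  assumes "e x = 1"
  obtains j where "x = real_of_int j"
proof -
  have "cos (2 * pi * x) = 1" using assms by (simp add: e_eq_cis complex_eq_iff)
  then obtain j where "2 * pi * x = real_of_int j * 2 * pi" by (auto simp: cos_one_2pi_int)
  then have "x = real_of_int j" by simp
  then show ?thesis by (rule that)
qed

text \<open>The terms are the powers of an \<open>m\<close>-th root of unity, which is \<open>1\<close> exactly when \<open>m\<close> divides \<open>k\<close>;
  otherwise the geometric sum has a vanishing numerator.\<close>

lemma sum_e_full_period:
  assumes "m > 0"
  shows "(\<Sum>j<m. e (real j * (real_of_int k / real m)))
       = (if int m dvd k then of_nat m else 0)"
proof (cases "int m dvd k")
  case True
  then obtain q where "k = int m * q" by auto
  then have "real_of_int k / real m = real_of_int q" using assms by simp
  then show ?thesis using True by (simp add: e_of_nat_mult)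
next
  case False
  have "e (real_of_int k / real m) \<noteq> 1"
  proof
    assume "e (real_of_int k / real m) = 1"
    then obtain j where "real_of_int k / real m = real_of_int j" by (rule e_eq_1_imp_int)
    then have "real_of_int k = real_of_int (int m * j)" using assms by (simp add: field_simps)
    then have "k = int m * j" by (simp only: of_int_eq_iff)
    with False show False by simp
  qed
  moreover have "e (real_of_int k / real m) ^ m = 1"
    using assms by (simp flip: e_of_nat_mult)
  ultimately show ?thesis using False
    by (simp add: e_of_nat_mult sum_gp_strict del: times_divide_eq_right)
qed

text \<open>The members of the progression in \<open>{1..n}\<close> are \<open>r + j D\<close> for \<open>j < n / D\<close>, where \<open>r\<close> represents the
  class of \<open>c\<close> in \<open>{1..D}\<close>, so the sum is a phase times a sum over a full period. Replacing \<open>r\<close>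
  by \<open>c\<close> in the phase changes \<open>r k / n\<close> by an integer multiple of \<open>k / (n / D)\<close>, which is an integer
  whenever the sum does not vanish.\<close>

lemma sum_e_arithmetic_progression:
  assumes "n > 0" "D dvd n"
  shows "(\<Sum>a | a \<in> {1..n} \<and> [int a = c] (mod int D). e (real_of_int (int a * k) / real n))
       = (if int (n div D) dvd k then of_nat (n div D) * e (real_of_int (c * k) / real n) else 0)"
proof -
  define m where "m = n div D"
  have n: "n = D * m" using assms by (simp add: m_def)
  have Dpos: "D > 0" and mpos: "m > 0" using assms(1) n by auto
  \<comment> \<open>Shifting by one before and after the reduction puts the representative in \<open>{1..D}\<close>
      instead of \<open>{0..<D}\<close>, to match the range \<open>{1..n}\<close>.\<close>
  define r where "r = nat ((c - 1) mod int D) + 1"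
  have r: "1 \<le> r" "r \<le> D"
    using Dpos pos_mod_bound[of "int D" "c - 1"] pos_mod_sign[of "int D" "c - 1"]
    by (auto simp: r_def Suc_le_eq nat_less_iff)
  have r_int: "int r = (c - 1) mod int D + 1" using Dpos by (simp add: r_def)
  have r_cong: "[int r = c] (mod int D)"
    unfolding r_int cong_def by (simp add: mod_simps)
  have "(\<Sum>a | a \<in> {1..n} \<and> [int a = c] (mod int D). e (real_of_int (int a * k) / real n))
      = (\<Sum>j<m. e (real_of_int (int (r + j * D) * k) / real n))"
  proof (rule sum.reindex_bij_witness[where i = "\<lambda>j. r + j * D" and j = "\<lambda>a. (a - 1) div D"])
    fix a assume a: "a \<in> {a. a \<in> {1..n} \<and> [int a = c] (mod int D)}"
    have "[int a - 1 = c - 1] (mod int D)" using a by (simp add: cong_diff)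
    then have "(int a - 1) mod int D = int r - 1" by (simp add: cong_def r_int)
    moreover have "int (a - 1) = int a - 1" using a by auto
    ultimately have "int ((a - 1) mod D) = int r - 1" by (metis zmod_int)
    then have "(a - 1) mod D + 1 = r" by linarith
    then show eq: "r + (a - 1) div D * D = a"
      using a div_mult_mod_eq[of "a - 1" D] by auto
    have "a - 1 < m * D" using a n by (auto simp: mult.commute)
    then show "(a - 1) div D \<in> {..<m}" by (simp add: less_mult_imp_div_less)
    show "e (real_of_int (int (r + (a - 1) div D * D) * k) / real n)
        = e (real_of_int (int a * k) / real n)" by (simp only: eq)
  next
    fix j assume j: "j \<in> {..<m}"
    have "r + j * D - 1 = (r - 1) + j * D" using r by simp
    moreover have "r - 1 < D" using r by simp
    ultimately show "(r + j * D - 1) div D = j" by simp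
    have "r + j * D \<le> (j + 1) * D" using r by simp
    also have "\<dots> \<le> m * D" using j by (intro mult_le_mono) auto
    finally have "r + j * D \<le> n" using n by (simp add: mult.commute)
    moreover have "[int (r + j * D) = c] (mod int D)"
      using r_cong by (simp add: cong_def)
    ultimately show "r + j * D \<in> {a. a \<in> {1..n} \<and> [int a = c] (mod int D)}" using r by simp
  qed
  also have "\<dots> = (\<Sum>j<m. e (real_of_int (int r * k) / real n) * e (real j * (real_of_int k / real m)))"
    using Dpos mpos by (intro sum.cong refl) (simp add: e_add[symmetric] n field_simps)
  also have "\<dots> = e (real_of_int (int r * k) / real n) * (if int m dvd k then of_nat m else 0)"
    by (simp only: sum_distrib_left[symmetric] sum_e_full_period[OF mpos])
  also have "\<dots> = (if int m dvd k then of_nat m * e (real_of_int (c * k) / real n) else 0)"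
  proof (cases "int m dvd k")
    case True
    then obtain q where q: "k = int m * q" by auto
    obtain u where "c - int r = int D * u"
      using cong_sym[OF r_cong] by (auto simp: cong_iff_dvd_diff)
    then have c: "c = int r + int D * u" by simp
    have "real_of_int (c * k) / real n = real_of_int (int r * k) / real n + real_of_int (u * q)"
      using Dpos mpos by (simp add: c q n field_simps)
    then have "e (real_of_int (c * k) / real n) = e (real_of_int (int r * k) / real n)"
      by (simp only: e_add e_of_int mult_1_right)
    then show ?thesis using True by simp
  qed simp
  finally show ?thesis by (simp only: m_def)
qed

text \<open>The two conditions on \<open>a\<close> say that \<open>a\<close> agrees with \<open>\<delta> x\<close> modulo \<open>d\<close> and modulo \<open>\<delta>\<close>; as these
  moduli are coprime, this is a congruence modulo their product.\<close>

lemma cong_and_dvd_iff_cong_mult: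
  fixes a s x :: int and d \<delta> :: nat
  assumes "coprime \<delta> d" "[int \<delta> * x = s] (mod int d)"
  shows "[a = s] (mod int d) \<and> int \<delta> dvd a \<longleftrightarrow> [a = int \<delta> * x] (mod int (d * \<delta>))"
proof
  assume *: "[a = s] (mod int d) \<and> int \<delta> dvd a"
  then have "[a = int \<delta> * x] (mod int d)" using assms(2) cong_trans cong_sym by blast
  moreover have "[a = int \<delta> * x] (mod int \<delta>)"
    using * by (simp add: cong_iff_dvd_diff)
  ultimately show "[a = int \<delta> * x] (mod int (d * \<delta>))"
    using assms(1) by (simp add: coprime_cong_mult coprime_commute)
next
  assume *: "[a = int \<delta> * x] (mod int (d * \<delta>))"
  then have "[a = int \<delta> * x] (mod int d)" and \<delta>: "[a = int \<delta> * x] (mod int \<delta>)"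
    by (auto simp: cong_iff_dvd_diff dest: dvd_mult_left dvd_mult_right)
  then have "[a = s] (mod int d)" using assms(2) cong_trans by blast
  moreover have "int \<delta> dvd a" using \<delta> by (metis cong_dvd_iff dvd_triv_left)
  ultimately show "[a = s] (mod int d) \<and> int \<delta> dvd a" by simp
qed

text \<open>Divisors \<open>\<delta>\<close> that share a factor with \<open>d\<close> contribute nothing, since a multiple of \<open>\<delta>\<close>
  is then not coprime to \<open>d\<close> while every member of the class of \<open>s\<close> is. The other \<open>\<delta>\<close> give
  full arithmetic progressions, whose sums survive exactly when \<open>n div (d * \<delta>)\<close> divides \<open>k\<close>.\<close>

lemma sum_e_progression_coprime:
  fixes x :: "nat \<Rightarrow> int"
  assumes n: "n > 0" and d: "d dvd n" and s: "coprime (int d) s"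
    and x: "\<And>\<delta>. \<delta> dvd n \<Longrightarrow> coprime \<delta> d \<Longrightarrow> int (n div (d * \<delta>)) dvd k \<Longrightarrow>
              [int \<delta> * x \<delta> = s] (mod int d)"
  shows "(\<Sum>a | a \<in> {1..n} \<and> coprime a n \<and> [int a = s] (mod int d).
            e (real_of_int (int a * k) / real n))
       = (\<Sum>\<delta> | \<delta> dvd n \<and> coprime \<delta> d \<and> int (n div (d * \<delta>)) dvd k.
            of_int (moebius_mu \<delta>) * of_nat (n div (d * \<delta>)) *
            e (real_of_int (int \<delta> * x \<delta> * k) / real n))"
proof -
  let ?E = "\<lambda>a. e (real_of_int (int a * k) / real n)"
  let ?T = "\<lambda>\<delta>. \<Sum>a | a \<in> {a \<in> {1..n}. [int a = s] (mod int d)} \<and> \<delta> dvd a. ?E a"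
  have fin: "finite {\<delta>. \<delta> dvd n}" using n by simp
  have vanish: "?T \<delta> = 0" if "\<not> coprime \<delta> d" for \<delta>
  proof -
    have "\<not> \<delta> dvd a" if a: "[int a = s] (mod int d)" for a
    proof
      assume "\<delta> dvd a"
      have "coprime (int a) (int d)"
        using cong_imp_coprime[OF cong_sym[OF a]] s by (simp add: coprime_commute)
      then have "coprime a d" by simp
      then have "coprime \<delta> d" using \<open>\<delta> dvd a\<close> by (rule coprime_divisors[rotated 2]) auto
      with \<open>\<not> coprime \<delta> d\<close> show False by simp
    qed
    then have "{a. a \<in> {a \<in> {1..n}. [int a = s] (mod int d)} \<and> \<delta> dvd a} = {}" by auto
    then show ?thesis by (simp only: sum.empty)
  qed
  have class_sum: "?T \<delta> = (if int (n div (d * \<delta>)) dvd k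
      then of_nat (n div (d * \<delta>)) * e (real_of_int (int \<delta> * x \<delta> * k) / real n) else 0)"
    if \<delta>: "\<delta> dvd n" "coprime \<delta> d" for \<delta>
  proof -
    have dvd: "d * \<delta> dvd n" using \<delta> d by (simp add: divides_mult coprime_commute)
    \<comment> \<open>When \<open>n div (d * \<delta>)\<close> does not divide \<open>k\<close>, nothing is known about \<open>x \<delta>\<close>. The progression sum
        then vanishes for every residue class, so any solution \<open>y\<close> of the congruence serves.\<close>
    obtain y where y: "[int \<delta> * y = s] (mod int d)"
      and xy: "int (n div (d * \<delta>)) dvd k \<Longrightarrow> y = x \<delta>"
    proof (cases "int (n div (d * \<delta>)) dvd k")
      case True
      then show ?thesis using x[OF \<delta>] that by blast
    next
      case False
      have "coprime (int \<delta>) (int d)" using \<delta> by simp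
      then obtain z where "[int \<delta> * z = 1] (mod int d)" using cong_solve_coprime_int by blast
      then have "[int \<delta> * z * s = 1 * s] (mod int d)" by (rule cong_scalar_right)
      then show ?thesis using False that[of "z * s"] by (simp add: mult.assoc)
    qed
    have "{a. a \<in> {a \<in> {1..n}. [int a = s] (mod int d)} \<and> \<delta> dvd a}
        = {a. a \<in> {1..n} \<and> [int a = int \<delta> * y] (mod int (d * \<delta>))}"
      using cong_and_dvd_iff_cong_mult[OF \<delta>(2) y, of "int a" for a] by auto
    then show ?thesis
      using xy by (simp only: sum_e_arithmetic_progression[OF n dvd]) auto
  qed
  have "(\<Sum>a | a \<in> {1..n} \<and> coprime a n \<and> [int a = s] (mod int d). ?E a)
      = (\<Sum>a | a \<in> {a \<in> {1..n}. [int a = s] (mod int d)} \<and> coprime a n. ?E a)"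
    by (rule sum.cong) auto
  also have "\<dots> = (\<Sum>\<delta> | \<delta> dvd n. of_int (moebius_mu \<delta>) * ?T \<delta>)"
    by (rule sum_coprime_via_moebius[OF n]) simp
  also have "\<dots> = (\<Sum>\<delta> | \<delta> dvd n \<and> coprime \<delta> d \<and> int (n div (d * \<delta>)) dvd k.
            of_int (moebius_mu \<delta>) * of_nat (n div (d * \<delta>)) *
            e (real_of_int (int \<delta> * x \<delta> * k) / real n))"
  proof (rule sum.mono_neutral_cong_right[OF fin])
    show "\<forall>\<delta>\<in>{\<delta>. \<delta> dvd n} - {\<delta>. \<delta> dvd n \<and> coprime \<delta> d \<and> int (n div (d * \<delta>)) dvd k}.
        of_int (moebius_mu \<delta>) * ?T \<delta> = 0"
    proof
      fix \<delta> assume "\<delta> \<in> {\<delta>. \<delta> dvd n} - {\<delta>. \<delta> dvd n \<and> coprime \<delta> d \<and> int (n div (d * \<delta>)) dvd k}"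
      then have "?T \<delta> = 0" using vanish[of \<delta>] class_sum[of \<delta>] by (cases "coprime \<delta> d") simp_all
      then show "of_int (moebius_mu \<delta>) * ?T \<delta> = 0" by (simp only: mult_zero_right)
    qed
  next
    fix \<delta> assume "\<delta> \<in> {\<delta>. \<delta> dvd n \<and> coprime \<delta> d \<and> int (n div (d * \<delta>)) dvd k}"
    then show "of_int (moebius_mu \<delta>) * ?T \<delta> = of_int (moebius_mu \<delta>) * of_nat (n div (d * \<delta>)) *
            e (real_of_int (int \<delta> * x \<delta> * k) / real n)"
      using class_sum[of \<delta>] by (simp only: mem_Collect_eq if_True mult.assoc)
  qed auto
  finally show ?thesis .
qed

section \<open>The evaluation of \<open>S f n k s\<close>\<close>

lemma S_expand_divisors:
  assumes "n > 0" "even_function_mod n f"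
  shows "S f n k s = (\<Sum>d | d dvd n \<and> coprime (int d) s. mu_conv f d *
           (\<Sum>a | a \<in> {1..n} \<and> coprime a n \<and> [int a = s] (mod int d).
              e (real_of_int (int a * k) / real n)))"
proof -
  let ?E = "\<lambda>a. e (real_of_int (int a * k) / real n)"
  let ?A = "{a. a \<in> {1..n} \<and> coprime a n}"
  let ?P = "\<lambda>d. {a. a \<in> {1..n} \<and> coprime a n \<and> [int a = s] (mod int d)}"
  have fin: "finite {d. d dvd n}" using assms(1) by simp
  have finA: "finite ?A" by (rule finite_subset[of _ "{1..n}"]) auto
  have "S f n k s = (\<Sum>a\<in>?A. \<Sum>d | d \<in> {d. d dvd n} \<and> int d dvd int a - s. mu_conv f d * ?E a)"
    unfolding S_def
    by (rule sum.cong[OF refl])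
       (subst even_function_mod_expand[OF assms], simp only: sum_distrib_right mem_Collect_eq)
  also have "\<dots> = (\<Sum>d\<in>{d. d dvd n}. \<Sum>a | a \<in> ?A \<and> int d dvd int a - s. mu_conv f d * ?E a)"
    using finA fin by (rule sum.swap_restrict)
  also have "\<dots> = (\<Sum>d | d dvd n. mu_conv f d * (\<Sum>a\<in>?P d. ?E a))"
    by (intro sum.cong) (simp_all add: sum_distrib_left cong_iff_dvd_diff conj_assoc)
  also have "\<dots> = (\<Sum>d | d dvd n \<and> coprime (int d) s. mu_conv f d * (\<Sum>a\<in>?P d. ?E a))"
  proof (rule sum.mono_neutral_right[OF fin])
    show "\<forall>d\<in>{d. d dvd n} - {d. d dvd n \<and> coprime (int d) s}. mu_conv f d * (\<Sum>a\<in>?P d. ?E a) = 0"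
    proof
      fix d assume d: "d \<in> {d. d dvd n} - {d. d dvd n \<and> coprime (int d) s}"
      \<comment> \<open>A unit modulo \<open>n\<close> is a unit modulo \<open>d\<close>, so it cannot be congruent to \<open>s\<close>.\<close>
      have "coprime (int d) s" if a: "coprime a n" "[int a = s] (mod int d)" for a
      proof -
        have "coprime a d" using a(1) d by (auto intro: coprime_divisors)
        then have "coprime (int a) (int d)" by simp
        then show ?thesis using cong_imp_coprime[OF a(2)] by (simp add: coprime_commute)
      qed
      then have "?P d = {}" using d by auto
      then show "mu_conv f d * (\<Sum>a\<in>?P d. ?E a) = 0" by (simp only: sum.empty mult_zero_right)
    qed
  qed auto
  finally show ?thesis .
qed

theorem theorem3p1:
  fixes n :: nat and s k :: int and f :: "int \<Rightarrow> complex"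
    and \<delta>' :: "nat \<Rightarrow> nat \<Rightarrow> int"
  assumes "n \<ge> 1"
    and "even_function_mod n f"
    and "\<And>d \<delta>. d dvd n \<Longrightarrow> coprime (int d) s \<Longrightarrow> \<delta> dvd n \<Longrightarrow> coprime \<delta> d \<Longrightarrow>
           int (n div (d * \<delta>)) dvd k \<Longrightarrow> [int \<delta> * \<delta>' d \<delta> = s] (mod int d)"
  shows "S f n k s =
           of_nat n * (\<Sum>d | d dvd n \<and> coprime (int d) s.
             mu_conv f d / of_nat d *
             (\<Sum>\<delta> | \<delta> dvd n \<and> coprime \<delta> d \<and> int (n div (d * \<delta>)) dvd k.
                of_int (moebius_mu \<delta>) / of_nat \<delta> *
                e (real_of_int (int \<delta> * \<delta>' d \<delta> * k) / real n)))
         \<and> S f n k s =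
           (\<Sum>t | int t dvd gcd (int n) k.
             of_nat t *
             (\<Sum>(d, \<delta>) | d * \<delta> = n div t \<and> coprime (int d) (int \<delta> * s).
                mu_conv f d * of_int (moebius_mu \<delta>) *
                e (real_of_int (int \<delta> * \<delta>' d \<delta> * k) / real n)))"
proof -
  let ?e = "\<lambda>d \<delta>. e (real_of_int (int \<delta> * \<delta>' d \<delta> * k) / real n)"
  let ?D = "\<lambda>d. {\<delta>. \<delta> dvd n \<and> coprime \<delta> d \<and> int (n div (d * \<delta>)) dvd k}"
  let ?N = "\<lambda>t. {(d, \<delta>). d * \<delta> = n div t \<and> coprime (int d) (int \<delta> * s)}"
  have n: "n > 0" using assms(1) by simp
  have S_eq: "S f n k s = (\<Sum>d | d dvd n \<and> coprime (int d) s. \<Sum>\<delta>\<in>?D d.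
      mu_conv f d * of_int (moebius_mu \<delta>) * of_nat (n div (d * \<delta>)) * ?e d \<delta>)"
    unfolding S_expand_divisors[OF n assms(2)]
  proof (rule sum.cong[OF refl])
    fix d assume d: "d \<in> {d. d dvd n \<and> coprime (int d) s}"
    show "mu_conv f d * (\<Sum>a | a \<in> {1..n} \<and> coprime a n \<and> [int a = s] (mod int d).
              e (real_of_int (int a * k) / real n))
        = (\<Sum>\<delta>\<in>?D d. mu_conv f d * of_int (moebius_mu \<delta>) * of_nat (n div (d * \<delta>)) * ?e d \<delta>)"
    proof (subst sum_e_progression_coprime[OF n, where x = "\<delta>' d"])
      show "d dvd n" "coprime (int d) s" using d by simp_all
      then show "[int \<delta> * \<delta>' d \<delta> = s] (mod int d)"
        if "\<delta> dvd n" "coprime \<delta> d" "int (n div (d * \<delta>)) dvd k" for \<delta>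
        using that by (intro assms(3))
    qed (simp only: sum_distrib_left mult.assoc)
  qed
  have first: "S f n k s = of_nat n * (\<Sum>d | d dvd n \<and> coprime (int d) s.
      mu_conv f d / of_nat d * (\<Sum>\<delta>\<in>?D d. of_int (moebius_mu \<delta>) / of_nat \<delta> * ?e d \<delta>))"
    unfolding S_eq sum_distrib_left
  proof (intro sum.cong refl)
    fix d \<delta> assume d: "d \<in> {d. d dvd n \<and> coprime (int d) s}" and \<delta>: "\<delta> \<in> ?D d"
    have "d * \<delta> dvd n" using d \<delta> by (simp add: divides_mult coprime_commute)
    then have "of_nat (n div (d * \<delta>)) = (of_nat n / (of_nat d * of_nat \<delta>) :: complex)"
      by (auto simp: field_simps elim: dvdE)
    then show "mu_conv f d * of_int (moebius_mu \<delta>) * of_nat (n div (d * \<delta>)) * ?e d \<delta>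
        = of_nat n * (mu_conv f d / of_nat d * (of_int (moebius_mu \<delta>) / of_nat \<delta> * ?e d \<delta>))"
      by simp
  qed
  have fin_D: "finite (?D d)" for d using n by simp
  have fin_N: "finite (?N t)" if "int t dvd gcd (int n) k" for t
  proof -
    have "t dvd n" using that by auto
    then have "n div t > 0" using n by (auto elim: dvdE)
    then have "finite {(d, \<delta>). d * \<delta> = n div t}" by (rule finite_factor_pairs)
    then show ?thesis by (rule rev_finite_subset) auto
  qed
  have fin_T: "finite {t. int t dvd gcd (int n) k}"
    by (rule finite_subset[of _ "{t. t dvd n}"]) (use n in auto)
  have "S f n k s = (\<Sum>(d, \<delta>)\<in>Sigma {d. d dvd n \<and> coprime (int d) s} ?D.
      mu_conv f d * of_int (moebius_mu \<delta>) * of_nat (n div (d * \<delta>)) * ?e d \<delta>)"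
    unfolding S_eq using n fin_D by (subst sum.Sigma) auto
  \<comment> \<open>The complementary divisor \<open>t = n div (d * \<delta>)\<close> becomes the outer summation variable.\<close>
  also have "\<dots> = (\<Sum>(t, (d, \<delta>))\<in>Sigma {t. int t dvd gcd (int n) k} ?N.
      of_nat t * (mu_conv f d * of_int (moebius_mu \<delta>) * ?e d \<delta>))"
  proof (rule sum.reindex_bij_witness[where i = "\<lambda>(t, (d, \<delta>)). (d, \<delta>)"
          and j = "\<lambda>(d, \<delta>). (n div (d * \<delta>), (d, \<delta>))"])
    fix p assume p: "p \<in> Sigma {d. d dvd n \<and> coprime (int d) s} ?D"
    obtain d \<delta> where [simp]: "p = (d, \<delta>)" by (cases p)
    have "d * \<delta> dvd n" using p by (simp add: divides_mult coprime_commute)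
    then obtain t where "n = d * \<delta> * t" by auto
    then show "(case p of (d, \<delta>) \<Rightarrow> (n div (d * \<delta>), d, \<delta>))
        \<in> Sigma {t. int t dvd gcd (int n) k} ?N"
      using p n by (auto simp: coprime_commute)
  next
    fix q assume q: "q \<in> Sigma {t. int t dvd gcd (int n) k} ?N"
    obtain t d \<delta> where [simp]: "q = (t, (d, \<delta>))" by (cases q)
    have "t dvd n" using q by auto
    moreover have "d * \<delta> = n div t" using q by simp
    ultimately have nt: "n = d * \<delta> * t" by simp
    then have t: "n div (d * \<delta>) = t" using n by simp
    have k_s: "int t dvd k" "coprime (int d) s" "coprime \<delta> d"
      using q by (auto simp: coprime_commute)
    have "d dvd n" "\<delta> dvd n" using nt by auto
    then show "(case q of (t, d, \<delta>) \<Rightarrow> (d, \<delta>)) \<in> Sigma {d. d dvd n \<and> coprime (int d) s} ?D"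
      using k_s by (simp add: t)
    show "(case case q of (t, d, \<delta>) \<Rightarrow> (d, \<delta>) of (d, \<delta>) \<Rightarrow> (n div (d * \<delta>), d, \<delta>)) = q"
      by (simp add: t)
  qed (auto simp: mult_ac)
  also have "\<dots> = (\<Sum>t | int t dvd gcd (int n) k. of_nat t *
      (\<Sum>(d, \<delta>)\<in>?N t. mu_conv f d * of_int (moebius_mu \<delta>) * ?e d \<delta>))"
    using fin_T fin_N
    by (subst sum.Sigma[symmetric]) (auto simp: sum_distrib_left case_prod_beta intro!: sum.cong)
  finally show ?thesis using first by blast
qed

end
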